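(* For every real $\varepsilon>0$ there exist a finite set $V$ and an admissible function $w:2^V\to\mathbb{R}_{\ge 0}$ such that $\delta(w)<\varepsilon$.
   Context: Let $V$ be a finite set and $2^V$ its power set. A function $w:2^V\to\mathbb{R}_{\ge0}$ is called admissible if it is not identically zero, $w(\varnothing)=0$, and $w(A\cup B)\ge\min\{w(A),w(B)\}$ for all $A,B\subseteq V$. For an admissible $w$ and $x\in V$ put $p_x(w)=\dfrac{\sum_{A\subseteq V,\,x\in A}w(A)}{\sum_{A\subseteq V}w(A)}$, and $\delta(w)=\max_{x\in V}p_x(w)$. (An admissible function can exist only if $V\neq\varnothing$.) *)

theory Defs
  imports Complex_Main
begin

text \<open>A function on the power set of \<open>V\<close> is represented by a total function on all sets
  over the type; only its values on subsets of \<open>V\<close> are constrained or used.\<close>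

definition admissible :: "'a set \<Rightarrow> ('a set \<Rightarrow> real) \<Rightarrow> bool" where
  "admissible V w \<longleftrightarrow>
     (\<forall>A\<in>Pow V. w A \<ge> 0) \<and>
     (\<exists>A\<in>Pow V. w A \<noteq> 0) \<and>
     w {} = 0 \<and>
     (\<forall>A\<in>Pow V. \<forall>B\<in>Pow V. w (A \<union> B) \<ge> min (w A) (w B))"

definition elem_freq :: "'a set \<Rightarrow> ('a set \<Rightarrow> real) \<Rightarrow> 'a \<Rightarrow> real" where
  "elem_freq V w x = (\<Sum>A\<in>{A \<in> Pow V. x \<in> A}. w A) / (\<Sum>A\<in>Pow V. w A)"

text \<open>The maximum is meaningful for finite nonempty \<open>V\<close>; nonemptiness follows from
  admissibility, since some subset of \<open>V\<close> other than the empty set has nonzero weight.\<close>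

definition max_freq :: "'a set \<Rightarrow> ('a set \<Rightarrow> real) \<Rightarrow> real" where
  "max_freq V w = Max (elem_freq V w ` V)"

end

theory Submission
  imports Defs "HOL-Library.Nat_Bijection"
begin

text \<open>
  If \<open>F\<^sub>0 \<subseteq> F\<^sub>1 \<subseteq> \<dots>\<close> are union-closed families without the empty set, then
  \<open>w = \<Sum>k<m. 1\<^sub>F\<^sub>k / |F\<^sub>k|\<close> is admissible, and the frequency of \<open>x\<close> under \<open>w\<close> is the average of its
  frequencies in the \<open>F\<^sub>k\<close>. So it suffices that each \<open>x\<close> is rare in all but two of the \<open>F\<^sub>k\<close>.

  Take pairwise disjoint blocks \<open>B\<^sub>j\<^sub>k\<close> (\<open>j < k\<close>) whose size depends on \<open>k\<close> only and grows fast, and put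
  \<open>S\<^sub>j = \<Union>k>j. B\<^sub>j\<^sub>k\<close> and \<open>W\<^sub>k = \<Union>j<k. B\<^sub>j\<^sub>k\<close>. The family \<open>F\<^sub>k\<close> is generated by the cubes
  \<open>M\<^sub>i = {S\<^sub>i \<union> A | A \<subseteq> W\<^sub>i}\<close> with \<open>i \<le> k\<close>. Every set of \<open>F\<^sub>k\<^sub>-\<^sub>1\<close> contains some \<open>S\<^sub>j\<close> with \<open>j < k\<close>,
  hence \<open>B\<^sub>j\<^sub>k\<close>, so its unions with members of \<open>M\<^sub>k\<close> are few compared with \<open>M\<^sub>k\<close>: almost
  all of \<open>F\<^sub>k\<close> is \<open>M\<^sub>k\<close>, which only involves \<open>S\<^sub>k \<union> W\<^sub>k\<close>. A point of \<open>B\<^sub>j\<^sub>k\<close> lies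
  in \<open>S\<^sub>i \<union> W\<^sub>i\<close> only for \<open>i = j\<close> and \<open>i = k\<close>.
\<close>

lemma admissible_of_chain:
  fixes V :: "'a set" and F :: "nat \<Rightarrow> 'a set set"
  assumes V: "finite V" and m: "m > 0"
    and sub: "\<And>k. k < m \<Longrightarrow> F k \<subseteq> Pow V"
    and ne: "\<And>k. k < m \<Longrightarrow> F k \<noteq> {}"
    and empty: "\<And>k. k < m \<Longrightarrow> {} \<notin> F k"
    and mono: "mono F"
    and union: "\<And>k A B. A \<in> F k \<Longrightarrow> B \<in> F k \<Longrightarrow> A \<union> B \<in> F k"
    and freq: "\<And>x. x \<in> V \<Longrightarrow> (\<Sum>k<m. card {A \<in> F k. x \<in> A} / card (F k)) \<le> c"
  shows "\<exists>w. admissible V w \<and> max_freq V w \<le> c / m"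
proof -
  define w where "w A = (\<Sum>k<m. if A \<in> F k then 1 / real (card (F k)) else 0)" for A
  have fin: "finite (F k)" if "k < m" for k
    using sub[OF that] V by (simp add: finite_subset)
  have sumw: "(\<Sum>A\<in>{A \<in> Pow V. P A}. w A) = (\<Sum>k<m. card {A \<in> F k. P A} / card (F k))" for P
  proof -
    have "(\<Sum>A\<in>{A \<in> Pow V. P A}. if A \<in> F k then 1 / real (card (F k)) else 0)
        = card {A \<in> F k. P A} / card (F k)" if "k < m" for k
    proof -
      have "{A \<in> Pow V. P A} \<inter> F k = {A \<in> F k. P A}"
        using sub[OF that] by auto
      then show ?thesis
        using V by (simp add: sum.inter_restrict[symmetric])
    qed
    then show ?thesis
      unfolding w_def by (subst sum.swap) simp
  qed
  have total: "(\<Sum>A\<in>Pow V. w A) = m"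
    using sumw[of "\<lambda>_. True"] fin ne by (simp add: Pow_def)
  have freq_le: "elem_freq V w x \<le> c / m" if "x \<in> V" for x
    unfolding elem_freq_def total sumw using freq[OF that] by (simp add: divide_right_mono)
  have min_le: "w (A \<union> B) \<ge> w A" if "\<forall>k. A \<in> F k \<longrightarrow> B \<in> F k" for A B
    unfolding w_def using that union by (intro sum_mono) auto
  have "w (A \<union> B) \<ge> min (w A) (w B)" for A B
  proof (cases "\<forall>k. A \<in> F k \<longrightarrow> B \<in> F k")
    case True
    then show ?thesis using min_le by (simp add: min.coboundedI1)
  next
    case False
    then obtain k where k: "A \<in> F k" "B \<notin> F k" by blast
    have "A \<in> F l" if "B \<in> F l" for l
      using k that monoD[OF mono, of k l] monoD[OF mono, of l k] by (meson nat_le_linear subsetD)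
    then show ?thesis
      using min_le[of B A] by (simp add: Un_commute min.coboundedI2)
  qed
  moreover have "w A \<ge> 0" for A
    unfolding w_def by (simp add: sum_nonneg)
  moreover have "\<exists>A\<in>Pow V. w A \<noteq> 0"
    using total m by (metis of_nat_0_less_iff order_less_irrefl sum.neutral)
  moreover have "w {} = 0"
    unfolding w_def using empty by simp
  ultimately have "admissible V w"
    unfolding admissible_def by blast
  moreover have "V \<noteq> {}"
    using sub[OF m] ne[OF m] empty[OF m] by auto
  then have "max_freq V w \<le> c / m"
    unfolding max_freq_def using V freq_le by simp
  ultimately show ?thesis by blast
qed

definition cube :: "'a set \<Rightarrow> 'a set \<Rightarrow> 'a set set" where
  "cube S W = (\<union>) S ` Pow W"

definition joins :: "'a set set \<Rightarrow> 'a set set \<Rightarrow> 'a set set" where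
  "joins G H = (\<lambda>(A, B). A \<union> B) ` (G \<times> H)"

lemma finite_cube: "finite W \<Longrightarrow> finite (cube S W)"
  by (simp add: cube_def)

lemma card_cube_le: "finite W \<Longrightarrow> card (cube S W) \<le> 2 ^ card W"
  unfolding cube_def by (metis card_Pow card_image_le finite_Pow_iff)

lemma card_cube:
  assumes "finite W" "S \<inter> W = {}"
  shows "card (cube S W) = 2 ^ card W"
proof -
  have "inj_on ((\<union>) S) (Pow W)"
    using assms(2) by (intro inj_onI) blast
  then show ?thesis
    using assms(1) by (simp add: cube_def card_image card_Pow)
qed

lemma cube_union: "A \<in> cube S W \<Longrightarrow> B \<in> cube S W \<Longrightarrow> A \<union> B \<in> cube S W"
  unfolding cube_def by (auto intro!: image_eqI[where x = "_ \<union> _"])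

lemma finite_joins: "finite G \<Longrightarrow> finite H \<Longrightarrow> finite (joins G H)"
  by (simp add: joins_def)

lemma card_joins_le: "finite G \<Longrightarrow> finite H \<Longrightarrow> card (joins G H) \<le> card G * card H"
  unfolding joins_def by (metis card_cartesian_product card_image_le finite_cartesian_product)

lemma card_joins_cube_le:
  fixes G :: "'a set set" and T :: "nat \<Rightarrow> 'a set"
  assumes G: "finite G" and W: "finite W"
    and cover: "\<And>A. A \<in> G \<Longrightarrow> \<exists>j<n. T j \<subseteq> A"
    and meet: "\<And>j. j < n \<Longrightarrow> u \<le> card (W \<inter> T j)"
  shows "card (joins G (cube S W)) \<le> n * (card G * 2 ^ (card W - u))"
proof -
  define f where "f = (\<lambda>(A, D). A \<union> (S \<union> D))"
  have "joins G (cube S W) \<subseteq> (\<Union>j<n. f ` (G \<times> Pow (W - T j)))"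
  proof
    fix X assume "X \<in> joins G (cube S W)"
    then obtain A D where A: "A \<in> G" and D: "D \<subseteq> W" and X: "X = A \<union> (S \<union> D)"
      unfolding joins_def cube_def by auto
    obtain j where j: "j < n" "T j \<subseteq> A"
      using cover[OF A] by blast
    have "X = f (A, D - T j)"
      unfolding f_def X using j by auto
    with A D j show "X \<in> (\<Union>j<n. f ` (G \<times> Pow (W - T j)))"
      by blast
  qed
  then have "card (joins G (cube S W)) \<le> card (\<Union>j<n. f ` (G \<times> Pow (W - T j)))"
    using G W by (intro card_mono) auto
  also have "\<dots> \<le> (\<Sum>j<n. card (f ` (G \<times> Pow (W - T j))))"
    by (rule card_UN_le) simp
  also have "\<dots> \<le> (\<Sum>j<n. card G * 2 ^ (card W - u))"
  proof (rule sum_mono)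
    fix j assume "j \<in> {..<n}"
    then have "card (W - T j) \<le> card W - u"
      using meet[of j] W by (simp add: card_Diff_subset_Int)
    then have "card G * 2 ^ card (W - T j) \<le> card G * 2 ^ (card W - u)"
      by (simp add: power_increasing)
    moreover have "card (f ` (G \<times> Pow (W - T j))) \<le> card G * 2 ^ card (W - T j)"
      using card_image_le[of "G \<times> Pow (W - T j)" f] G W
      by (simp add: card_cartesian_product card_Pow)
    ultimately show "card (f ` (G \<times> Pow (W - T j))) \<le> card G * 2 ^ (card W - u)"
      by (rule order_trans[rotated])
  qed
  finally show ?thesis by simp
qed

text \<open>The recursion makes \<open>2 ^ log_size m k\<close> exceed the size of the \<open>k\<close>-th family, while a block
  of size \<open>log_size m k + 2 * m\<close> beats that family by a factor \<open>4 ^ m\<close>.\<close>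

primrec log_size :: "nat \<Rightarrow> nat \<Rightarrow> nat" where
  "log_size m 0 = 1"
| "log_size m (Suc k) = Suc (log_size m k + Suc k * (log_size m k + 2 * m))"

definition block_size :: "nat \<Rightarrow> nat \<Rightarrow> nat" where
  "block_size m k = log_size m (k - 1) + 2 * m"

definition block :: "nat \<Rightarrow> nat \<Rightarrow> nat \<Rightarrow> nat set" where
  "block m j k = (\<lambda>i. prod_encode (prod_encode (j, k), i)) ` {..<block_size m k}"

definition core :: "nat \<Rightarrow> nat \<Rightarrow> nat set" where
  "core m j = (\<Union>k\<in>{j<..m}. block m j k)"

definition free :: "nat \<Rightarrow> nat \<Rightarrow> nat set" where
  "free m k = (\<Union>j<k. block m j k)"

primrec family :: "nat \<Rightarrow> nat \<Rightarrow> nat set set" where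
  "family m 0 = cube (core m 0) (free m 0)"
| "family m (Suc k) = cube (core m (Suc k)) (free m (Suc k))
     \<union> (family m k \<union> joins (family m k) (cube (core m (Suc k)) (free m (Suc k))))"

lemma finite_block: "finite (block m j k)"
  by (simp add: block_def)

lemma card_block: "card (block m j k) = block_size m k"
  unfolding block_def by (subst card_image) (auto simp: inj_on_def)

lemma block_disjoint: "x \<in> block m j k \<Longrightarrow> x \<in> block m j' k' \<Longrightarrow> j = j' \<and> k = k'"
  unfolding block_def by auto

lemma finite_free: "finite (free m k)"
  by (simp add: free_def finite_block)

lemma card_free: "card (free m k) = k * block_size m k"
  unfolding free_def
  by (subst card_UN_disjoint) (auto simp: finite_block card_block dest: block_disjoint)

lemma core_free_disjoint: "core m k \<inter> free m k = {}"
  unfolding core_def free_def using block_disjoint by fastforce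

lemma block_size_le_card_meet:
  assumes "j < k" "k \<le> m"
  shows "block_size m k \<le> card (free m k \<inter> core m j)"
proof -
  have "block m j k \<subseteq> free m k \<inter> core m j"
    using assms unfolding free_def core_def by auto
  then show ?thesis
    by (metis card_block card_mono finite_Int finite_free)
qed

lemma finite_family: "finite (family m k)"
  by (induction k) (auto simp: finite_cube finite_free finite_joins)

lemma family_nonempty: "family m k \<noteq> {}"
  by (induction k) (auto simp: cube_def)

lemma cube_core_subset: "A \<in> cube (core m j) W \<Longrightarrow> core m j \<subseteq> A"
  by (auto simp: cube_def)

lemma family_contains_core: "A \<in> family m k \<Longrightarrow> \<exists>j<Suc k. core m j \<subseteq> A"
proof (induction k arbitrary: A)
  case 0
  then show ?case by (auto dest: cube_core_subset)
next
  case (Suc k)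
  then show ?case
    unfolding family.simps joins_def
    by (fastforce dest: cube_core_subset simp: less_Suc_eq)
qed

lemma family_subset: "A \<in> family m k \<Longrightarrow> A \<subseteq> (\<Union>j\<le>k. core m j \<union> free m j)"
proof (induction k arbitrary: A)
  case 0
  then show ?case by (auto simp: cube_def)
next
  case (Suc k)
  have cube: "B \<subseteq> (\<Union>j\<le>Suc k. core m j \<union> free m j)"
    if "B \<in> cube (core m (Suc k)) (free m (Suc k))" for B
    using that by (auto simp: cube_def)
  have IH: "B \<subseteq> (\<Union>j\<le>Suc k. core m j \<union> free m j)" if "B \<in> family m k" for B
    using Suc.IH[OF that] by (fastforce simp: le_Suc_eq)
  from Suc.prems consider "A \<in> cube (core m (Suc k)) (free m (Suc k))" | "A \<in> family m k"
    | B C where "A = B \<union> C" "B \<in> family m k" "C \<in> cube (core m (Suc k)) (free m (Suc k))"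
    by (auto simp: joins_def)
  then show ?case
    by cases (simp_all only: cube IH Un_least)
qed

lemma family_union: "A \<in> family m k \<Longrightarrow> B \<in> family m k \<Longrightarrow> A \<union> B \<in> family m k"
proof (induction k arbitrary: A B)
  case 0
  then show ?case by (simp add: cube_union)
next
  case (Suc k)
  define C where "C = cube (core m (Suc k)) (free m (Suc k))"
  have C: "X \<union> Y \<in> C" if "X \<in> C" "Y \<in> C" for X Y
    using that unfolding C_def by (rule cube_union)
  have split: "X \<in> family m (Suc k) \<longleftrightarrow>
      X \<in> C \<or> X \<in> family m k \<or> (\<exists>Y\<in>family m k. \<exists>Z\<in>C. X = Y \<union> Z)" for X
    by (auto simp: joins_def C_def)
  have Un: "X \<in> family m k \<Longrightarrow> Z \<in> C \<Longrightarrow> X \<union> Z \<in> family m (Suc k)" for X Z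
    unfolding split by blast
  have Un2: "X \<in> family m k \<Longrightarrow> Y \<in> family m (Suc k) \<Longrightarrow> X \<union> Y \<in> family m (Suc k)" for X Y
    unfolding split using Suc.IH by (metis Un_assoc)
  have Un3: "Z \<in> C \<Longrightarrow> Y \<in> family m (Suc k) \<Longrightarrow> Z \<union> Y \<in> family m (Suc k)" for Y Z
    unfolding split using C by (metis Un_assoc Un_commute)
  from Suc.prems(1) show ?case
    unfolding split[of A] using Un2 Un3 Suc.prems(2) by (metis Un_assoc)
qed

lemma mono_family: "mono (family m)"
  by (rule incseq_SucI) auto

lemma card_family: "card (family m k) + 1 \<le> 2 ^ log_size m k"
proof (induction k)
  case 0
  then show ?case by (simp add: cube_def free_def)
next
  case (Suc k)
  let ?G = "family m k" and ?C = "cube (core m (Suc k)) (free m (Suc k))"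
  note fin = finite_family[of m k] finite_cube[OF finite_free, of "core m (Suc k)" m "Suc k"]
  have "card (family m (Suc k)) \<le> card ?C + (card ?G + card (joins ?G ?C))"
    by (simp, intro order_trans[OF card_Un_le] add_left_mono card_Un_le)
  also have "\<dots> \<le> card ?C + (card ?G + card ?G * card ?C)"
    using card_joins_le[OF fin] by simp
  finally have "card (family m (Suc k)) \<le> card ?C + (card ?G + card ?G * card ?C)" .
  then have "card (family m (Suc k)) + 1 \<le> (card ?G + 1) * (card ?C + 1)"
    by simp
  also have "\<dots> \<le> 2 ^ log_size m k * 2 ^ Suc (card (free m (Suc k)))"
  proof (rule mult_mono[OF Suc.IH])
    have "card ?C \<le> 2 ^ card (free m (Suc k))"
      by (rule card_cube_le[OF finite_free])
    moreover have "(1 :: nat) \<le> 2 ^ card (free m (Suc k))"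
      by simp
    ultimately show "card ?C + 1 \<le> 2 ^ Suc (card (free m (Suc k)))"
      unfolding power_Suc by linarith
  qed simp_all
  also have "\<dots> = 2 ^ log_size m (Suc k)"
    by (simp add: card_free block_size_def flip: power_add)
  finally show ?case .
qed

lemma card_family_rest:
  assumes "Suc k < m"
  shows "m * card (family m k \<union> joins (family m k) (cube (core m (Suc k)) (free m (Suc k))))
    \<le> 2 ^ card (free m (Suc k))"
proof -
  let ?G = "family m k" and ?W = "free m (Suc k)" and ?u = "block_size m (Suc k)"
  have "card (joins ?G (cube (core m (Suc k)) ?W)) \<le> Suc k * (card ?G * 2 ^ (card ?W - ?u))"
    using assms
    by (intro card_joins_cube_le[where T = "core m"] finite_family finite_free
        family_contains_core block_size_le_card_meet) auto
  moreover have "card ?G \<le> card ?G * 2 ^ (card ?W - ?u)"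
    by simp
  ultimately have "card (?G \<union> joins ?G (cube (core m (Suc k)) ?W))
      \<le> Suc (Suc k) * (card ?G * 2 ^ (card ?W - ?u))"
    using card_Un_le[of ?G "joins ?G (cube (core m (Suc k)) ?W)"]
    unfolding mult_Suc[of "Suc k"] by linarith
  then have "m * card (?G \<union> joins ?G (cube (core m (Suc k)) ?W))
      \<le> m * (Suc (Suc k) * (card ?G * 2 ^ (card ?W - ?u)))"
    by (rule mult_left_mono) simp
  also have "\<dots> \<le> 2 ^ m * (2 ^ m * (2 ^ log_size m k * 2 ^ (card ?W - ?u)))"
  proof (intro mult_mono)
    show "m \<le> 2 ^ m" by (simp add: less_imp_le)
    then show "Suc (Suc k) \<le> 2 ^ m" using assms by linarith
    show "card ?G \<le> 2 ^ log_size m k" using card_family[of m k] by simp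
  qed simp_all
  also have "\<dots> = 2 ^ (?u + (card ?W - ?u))"
    by (simp add: block_size_def mult_2 ac_simps flip: power_add)
  also have "?u + (card ?W - ?u) = card ?W"
    by (simp add: card_free)
  finally show ?thesis .
qed

lemma family_freq_le:
  assumes "k < m" and x: "x \<notin> core m k \<union> free m k"
  shows "card {A \<in> family m k. x \<in> A} / card (family m k) \<le> 1 / m"
proof (cases k)
  case 0
  then have "{A \<in> family m k. x \<in> A} = {}"
    using x by (auto simp: cube_def)
  then show ?thesis by (simp only:) simp
next
  case (Suc l)
  let ?C = "cube (core m k) (free m k)"
  let ?R = "family m l \<union> joins (family m l) ?C"
  have "{A \<in> family m k. x \<in> A} \<subseteq> ?R"
    using x Suc by (auto simp: cube_def)
  then have "card {A \<in> family m k. x \<in> A} \<le> card ?R"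
    by (intro card_mono) (auto simp: finite_family finite_cube finite_free finite_joins)
  then have "m * card {A \<in> family m k. x \<in> A} \<le> m * card ?R"
    by (rule mult_left_mono) simp
  also have "\<dots> \<le> 2 ^ card (free m k)"
    using card_family_rest[of l m] assms(1) Suc by simp
  also have "\<dots> = card ?C"
    by (simp add: card_cube finite_free core_free_disjoint)
  also have "\<dots> \<le> card (family m k)"
    using Suc by (intro card_mono finite_family) auto
  finally have "m * card {A \<in> family m k. x \<in> A} \<le> card (family m k)" .
  then have "real m * card {A \<in> family m k. x \<in> A} \<le> card (family m k)"
    by (metis of_nat_le_iff of_nat_mult)
  moreover have "card (family m k) > 0"
    using family_nonempty finite_family by (simp add: card_gt_0_iff)
  ultimately show ?thesis
    using assms(1) by (simp add: field_simps)
qed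

lemma core_free_indices:
  assumes "x \<in> block m j k" "x \<in> core m i \<union> free m i"
  shows "i \<in> {j, k}"
  using assms unfolding core_def free_def by (auto dest: block_disjoint)

lemma sum_family_freq_le:
  assumes m: "m > 0" and x: "x \<in> block m j k"
  shows "(\<Sum>i<m. card {A \<in> family m i. x \<in> A} / card (family m i)) \<le> 3"
proof -
  let ?p = "\<lambda>i. card {A \<in> family m i. x \<in> A} / card (family m i)"
  have "?p i \<le> 1" for i
    using card_mono[OF finite_family, of "{A \<in> family m i. x \<in> A}" m i]
    by (simp add: divide_le_eq_1 card_gt_0_iff finite_family family_nonempty)
  then have "?p i \<le> (if i = j then 1 else 0) + (if i = k then 1 else 0) + 1 / m" if "i < m" for i
  proof (cases "i \<in> {j, k}")
    case True
    have "0 \<le> 1 / real m" by simp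
    with \<open>?p i \<le> 1\<close> True show ?thesis by (auto simp: add_increasing2)
  next
    case False
    then show ?thesis
      using family_freq_le[OF that, of x] core_free_indices[OF x, of i] by auto
  qed
  then have "(\<Sum>i<m. ?p i)
      \<le> (\<Sum>i<m. (if i = j then 1 else 0) + (if i = k then 1 else 0) + 1 / m)"
    by (intro sum_mono) simp
  also have "\<dots> \<le> 3"
    using m by (simp add: sum.distrib)
  finally show ?thesis .
qed

lemma core_nonempty:
  assumes "k < m"
  shows "core m k \<noteq> {}"
proof -
  have "card (block m k m) > 0"
    using assms by (simp add: card_block block_size_def)
  then show ?thesis
    using assms unfolding core_def by fastforce
qed

theorem theorem1p3:
  fixes \<epsilon> :: real
  assumes "\<epsilon> > 0"
  shows "\<exists>(V :: nat set) (w :: nat set \<Rightarrow> real).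
           finite V \<and> admissible V w \<and> max_freq V w < \<epsilon>"
proof -
  obtain m :: nat where m: "3 / \<epsilon> < m"
    using reals_Archimedean2 by blast
  then have m0: "m > 0"
    using assms by (metis divide_pos_pos of_nat_0_less_iff order_less_trans zero_less_numeral)
  define V where "V = (\<Union>k\<le>m. \<Union>j<k. block m j k)"
  have V: "finite V"
    by (simp add: V_def finite_block)
  have core_free: "core m j \<union> free m j \<subseteq> V" if "j \<le> m" for j
    using that unfolding V_def core_def free_def by fastforce
  have "\<exists>w. admissible V w \<and> max_freq V w \<le> 3 / m"
  proof (rule admissible_of_chain[OF V m0 _ family_nonempty _ mono_family family_union])
    fix k assume k: "k < m"
    show "family m k \<subseteq> Pow V"
    proof (intro subsetI PowI)
      fix A x assume "A \<in> family m k" "x \<in> A"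
      then obtain j where "j \<le> k" "x \<in> core m j \<union> free m j"
        using family_subset by blast
      then show "x \<in> V"
        using core_free[of j] k by (meson less_imp_le order_trans subsetD)
    qed
    show "{} \<notin> family m k"
    proof
      assume "{} \<in> family m k"
      then obtain j where "j < Suc k" "core m j \<subseteq> {}"
        using family_contains_core by blast
      then show False
        using core_nonempty[of j m] k by simp
    qed
  next
    fix x assume "x \<in> V"
    then obtain j k where "x \<in> block m j k"
      unfolding V_def by blast
    then show "(\<Sum>k<m. card {A \<in> family m k. x \<in> A} / card (family m k)) \<le> 3"
      by (rule sum_family_freq_le[OF m0])
  qed
  then obtain w where w: "admissible V w" "max_freq V w \<le> 3 / m"
    by blast
  have "3 / m < \<epsilon>"
    using m m0 assms by (simp add: field_simps)
  with V w show ?thesis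
    by (meson order_le_less_trans)
qed

end
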